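(* Let $n\ge 1$ and consider a system with components $1,\dots,n$, component lifetimes $T_1,\dots,T_n$ and system lifetime $T_S$, all being $[0,\infty]$-valued random variables on a common probability space. (i) If the system has structure function $\phi_v:\{0,1\}^n\to\{0,1\}$, where $\phi_v$ is nondecreasing and nonconstant, then $$T_S=p_w(T_1,\dots,T_n),\qquad\text{where } w=\gamma\circ v .$$ (ii) Conversely, if $T_S=p_w(T_1,\dots,T_n)$ for some lattice polynomial function $p_w:[0,\infty]^n\to[0,\infty]$, then the system has the nondecreasing and nonconstant structure function $\phi_v$, where $v=\gamma^{-1}\circ w$.
   Context: Write $[n]=\{1,\dots,n\}$. For an event $E$, $\mathrm{Ind}(E)$ is the indicator random variable of $E$ ($1$ if $E$ occurs, $0$ otherwise). Components are nonrepairable. For $t\in[0,\infty)$ put $X_i(t)=\mathrm{Ind}(T_i>t)$ (state of component $i$ at time $t$), $\mathbf X(t)=(X_1(t),\dots,X_n(t))$, and $X_S(t)=\mathrm{Ind}(T_S>t)$ (state of the system at time $t$). The system "has structure function $\phi:\{0,1\}^n\to\{0,1\}$" means that $X_S(t)=\phi(\mathbf X(t))$ for all $t\ge 0$ (pointwise on the probability space; likewise equalities between lifetimes are pointwise). A set function $v:2^{[n]}\to\{0,1\}$ is identified with the Boolean function $\phi_v(\mathbf x)=\sum_{A\subseteq[n]}v(A)\prod_{i\in A}x_i\prod_{i\in[n]\setminus A}(1-x_i)$ on $\{0,1\}^n$; that is, $v(A)=\phi_v(\mathbf 1_A)$, where $\mathbf 1_A\in\{0,1\}^n$ is the characteristic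 vector of $A$. Every function $\{0,1\}^n\to\{0,1\}$ is of the form $\phi_v$ for a unique $v$. Monotonicity of $\phi_v$ is with respect to the componentwise order, that of $v$ with respect to inclusion. Let $L=[0,\infty]$ with lattice operations $\wedge=\min$ and $\vee=\max$. Lattice polynomial functions $L^n\to L$ are the functions obtained from the projections $\mathbf t\mapsto t_k$ ($k\in[n]$) by finitely many applications of $\wedge$ and $\vee$ (pointwise). Each such function can be written in exactly one way as $$p_w(\mathbf t)=\bigvee_{A\subseteq[n],\ w(A)=\infty}\ \bigwedge_{i\in A}t_i$$ with $w:2^{[n]}\to\{0,\infty\}$ nondecreasing and nonconstant (so $w(\varnothing)=0$ and $w([n])=\infty$), and $p_w$ denotes the lattice polynomial function so defined by such a $w$. The map $\gamma:\{0,1\}\to\{0,\infty\}$ is given by $\gamma(0)=0$, $\gamma(1)=\infty$. *)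

theory Defs
  imports "HOL-Probability.Probability"
begin

definition states :: "nat \<Rightarrow> (nat \<Rightarrow> nat) set" where
  "states n = {1..n} \<rightarrow>\<^sub>E {0, 1}"

definition boolean_set_functions :: "nat \<Rightarrow> (nat set \<Rightarrow> nat) set" where
  "boolean_set_functions n = Pow {1..n} \<rightarrow>\<^sub>E {0, 1}"

definition boolean_fun :: "nat \<Rightarrow> (nat set \<Rightarrow> nat) \<Rightarrow> (nat \<Rightarrow> nat) \<Rightarrow> nat" where
  "boolean_fun n v x =
     (\<Sum>A\<in>Pow {1..n}. v A * (\<Prod>i\<in>A. x i) * (\<Prod>i\<in>{1..n} - A. 1 - x i))"

text \<open>The state at time \<open>t\<close> of an item with lifetime \<open>T\<close>: the indicator of the event \<open>T > t\<close>.\<close>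

definition state_at :: "('a \<Rightarrow> ennreal) \<Rightarrow> real \<Rightarrow> 'a \<Rightarrow> nat" where
  "state_at T t = indicator {\<omega>. T \<omega> > ennreal t}"

definition has_structure_function ::
  "nat \<Rightarrow> 'a measure \<Rightarrow> (nat \<Rightarrow> 'a \<Rightarrow> ennreal) \<Rightarrow> ('a \<Rightarrow> ennreal) \<Rightarrow> ((nat \<Rightarrow> nat) \<Rightarrow> nat) \<Rightarrow> bool"
  where
  "has_structure_function n M T T\<^sub>S \<phi> \<longleftrightarrow>
     \<phi> \<in> states n \<rightarrow> {0, 1} \<and>
     (\<forall>t\<ge>0. \<forall>\<omega>\<in>space M. state_at T\<^sub>S t \<omega> = \<phi> (\<lambda>i\<in>{1..n}. state_at (T i) t \<omega>))"

text \<open>Lattice polynomial functions are represented on all of \<^typ>\<open>nat \<Rightarrow> ennreal\<close>, but they only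
  read the coordinates in \<open>{1..n}\<close>. Hence two of them are equal iff they agree on \<open>[0,\<infinity>]\<^sup>n\<close>.\<close>

inductive_set lattice_polynomials :: "nat \<Rightarrow> ((nat \<Rightarrow> ennreal) \<Rightarrow> ennreal) set" for n :: nat where
  proj: "k \<in> {1..n} \<Longrightarrow> (\<lambda>t. t k) \<in> lattice_polynomials n"
| inf: "\<lbrakk>p \<in> lattice_polynomials n; q \<in> lattice_polynomials n\<rbrakk>
    \<Longrightarrow> (\<lambda>t. inf (p t) (q t)) \<in> lattice_polynomials n"
| sup: "\<lbrakk>p \<in> lattice_polynomials n; q \<in> lattice_polynomials n\<rbrakk>
    \<Longrightarrow> (\<lambda>t. sup (p t) (q t)) \<in> lattice_polynomials n"

definition lp_set_functions :: "nat \<Rightarrow> (nat set \<Rightarrow> ennreal) set" where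
  "lp_set_functions n =
     {w \<in> Pow {1..n} \<rightarrow>\<^sub>E {0, \<infinity>}. mono_on (Pow {1..n}) w \<and> \<not> w constant_on Pow {1..n}}"

definition lattice_poly :: "nat \<Rightarrow> (nat set \<Rightarrow> ennreal) \<Rightarrow> (nat \<Rightarrow> ennreal) \<Rightarrow> ennreal" where
  "lattice_poly n w t = (SUP A\<in>{A \<in> Pow {1..n}. w A = \<infinity>}. INF i\<in>A. t i)"

definition gamma :: "nat \<Rightarrow> ennreal" where
  "gamma b = (if b = 0 then 0 else \<infinity>)"

definition gamma_inv :: "ennreal \<Rightarrow> nat" where
  "gamma_inv = the_inv_into {0, 1} gamma"

lemma lp_set_function_bounds:
  assumes "w \<in> lp_set_functions n"
  shows "w {} = 0" and "w {1..n} = \<infinity>"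
proof -
  have r: "w A \<in> {0, \<infinity>}" if "A \<subseteq> {1..n}" for A
    using assms that by (auto simp: lp_set_functions_def PiE_iff)
  have m: "w A \<le> w B" if "A \<subseteq> B" "B \<subseteq> {1..n}" for A B
    using assms that by (auto simp: lp_set_functions_def intro: mono_onD)
  have nc: "\<not> (\<exists>y. \<forall>A\<in>Pow {1..n}. w A = y)"
    using assms by (auto simp: lp_set_functions_def constant_on_def)
  show "w {} = 0"
  proof (rule ccontr)
    assume "w {} \<noteq> 0"
    then have e: "w {} = \<infinity>" using r[of "{}"] by auto
    have "w A = \<infinity>" if "A \<subseteq> {1..n}" for A using m[of "{}" A] that e by (simp add: top_unique)
    with nc show False by blast
  qed
  show "w {1..n} = \<infinity>"
  proof (rule ccontr)
    assume "w {1..n} \<noteq> \<infinity>"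
    then have e: "w {1..n} = 0" using r[of "{1..n}"] by auto
    have "w A = 0" if "A \<subseteq> {1..n}" for A using m[of A "{1..n}"] that e by simp
    with nc show False by blast
  qed
qed

lemma lp_set_function_infty_mono:
  assumes "w \<in> lp_set_functions n" "A \<subseteq> B" "B \<subseteq> {1..n}" "w A = \<infinity>"
  shows "w B = \<infinity>"
proof -
  have "w A \<le> w B"
    using assms(1-3) by (auto simp: lp_set_functions_def intro: mono_onD)
  then show ?thesis using assms(4) by (simp add: top_unique)
qed

lemma less_lattice_poly_iff:
  assumes w: "w \<in> lp_set_functions n"
  shows "c < lattice_poly n w t \<longleftrightarrow> w {i \<in> {1..n}. c < t i} = \<infinity>"
proof -
  have fin: "c < (INF i\<in>A. t i) \<longleftrightarrow> (\<forall>i\<in>A. c < t i)" if "A \<subseteq> {1..n}" "A \<noteq> {}" for A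
  proof -
    have "finite (t ` A)" using that finite_subset by blast
    then show ?thesis using that by (simp add: cInf_eq_Min)
  qed
  have ne: "A \<noteq> {}" if "w A = \<infinity>" for A
    using that lp_set_function_bounds(1)[OF w] by auto
  let ?B = "{i \<in> {1..n}. c < t i}"
  have "c < lattice_poly n w t \<longleftrightarrow> (\<exists>A\<subseteq>{1..n}. w A = \<infinity> \<and> (\<forall>i\<in>A. c < t i))"
    unfolding lattice_poly_def less_SUP_iff using fin ne by auto
  also have "\<dots> \<longleftrightarrow> w ?B = \<infinity>"
  proof
    assume "\<exists>A\<subseteq>{1..n}. w A = \<infinity> \<and> (\<forall>i\<in>A. c < t i)"
    then obtain A where A: "A \<subseteq> ?B" "w A = \<infinity>" by blast
    show "w ?B = \<infinity>" using lp_set_function_infty_mono[OF w A(1) _ A(2)] by blast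
  next
    assume "w ?B = \<infinity>"
    then show "\<exists>A\<subseteq>{1..n}. w A = \<infinity> \<and> (\<forall>i\<in>A. c < t i)"
      by (intro exI[of _ ?B]) auto
  qed
  finally show ?thesis .
qed

lemma lattice_poly_eqI:
  assumes "w \<in> lp_set_functions n"
    and "\<And>c t. c < p t \<longleftrightarrow> w {i \<in> {1..n}. c < t i} = \<infinity>"
  shows "p = lattice_poly n w"
proof
  fix t
  have "c < p t \<longleftrightarrow> c < lattice_poly n w t" for c
    using assms less_lattice_poly_iff by blast
  then show "p t = lattice_poly n w t"
    using less_irrefl linorder_less_linear[of "p t" "lattice_poly n w t"] by blast
qed

lemma lattice_poly_in_lattice_polynomials:
  assumes w: "w \<in> lp_set_functions n"
  shows "lattice_poly n w \<in> lattice_polynomials n"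
proof -
  have I: "(\<lambda>t. INF i\<in>A. t i) \<in> lattice_polynomials n" if "finite A" "A \<noteq> {}" "A \<subseteq> {1..n}" for A
    using that
  proof (induction A rule: finite_ne_induct)
    case (singleton k)
    then show ?case by (simp add: lattice_polynomials.proj)
  next
    case (insert k A)
    then show ?case
      using lattice_polynomials.inf[OF lattice_polynomials.proj[of k n]] by simp
  qed
  have S: "(\<lambda>t. SUP A\<in>F. INF i\<in>A. t i) \<in> lattice_polynomials n"
    if "finite F" "F \<noteq> {}" "F \<subseteq> Pow {1..n} - {{}}" for F
    using that
  proof (induction F rule: finite_ne_induct)
    case (singleton A)
    then show ?case using I[of A] finite_subset[of A "{1..n}"] by simp
  next
    case (insert A F)
    then show ?case
      using lattice_polynomials.sup[OF I[of A]] finite_subset[of A "{1..n}"] by simp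
  qed
  have "(\<lambda>t. SUP A\<in>{A \<in> Pow {1..n}. w A = \<infinity>}. INF i\<in>A. t i) \<in> lattice_polynomials n"
    using lp_set_function_bounds[OF w] by (intro S) auto
  then show ?thesis by (simp add: lattice_poly_def[abs_def])
qed

lemma lp_set_functionI:
  fixes P :: "nat set \<Rightarrow> bool"
  assumes "\<And>A B. \<lbrakk>A \<subseteq> B; B \<subseteq> {1..n}; P A\<rbrakk> \<Longrightarrow> P B" and "\<not> P {}" and "P {1..n}"
  shows "(\<lambda>A\<in>Pow {1..n}. if P A then \<infinity> else 0) \<in> lp_set_functions n" (is "?w \<in> _")
proof -
  have "mono_on (Pow {1..n}) ?w" using assms(1) by (auto intro!: mono_onI)
  moreover have "?w {} \<noteq> ?w {1..n}" using assms(2,3) by simp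
  then have "\<not> ?w constant_on Pow {1..n}"
    unfolding constant_on_def by (metis Pow_bottom Pow_top)
  ultimately show ?thesis by (auto simp: lp_set_functions_def)
qed

text \<open>Every lattice polynomial function is \<^term>\<open>lattice_poly n w\<close> for exactly one admissible \<open>w\<close>.\<close>

lemma bij_betw_lattice_poly:
  "bij_betw (lattice_poly n) (lp_set_functions n) (lattice_polynomials n)"
proof (rule bij_betw_imageI)
  show "inj_on (lattice_poly n) (lp_set_functions n)"
  proof (rule inj_onI)
    fix w w' assume w: "w \<in> lp_set_functions n" and w': "w' \<in> lp_set_functions n"
      and eq: "lattice_poly n w = lattice_poly n w'"
    have "w A = w' A" if A: "A \<subseteq> {1..n}" for A
    proof -
      let ?t = "\<lambda>i. if i \<in> A then 1 else (0::ennreal)"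
      have "{i \<in> {1..n}. 0 < ?t i} = A" using A by auto
      then have "w A = \<infinity> \<longleftrightarrow> w' A = \<infinity>"
        using less_lattice_poly_iff[OF w, of 0 ?t] less_lattice_poly_iff[OF w', of 0 ?t] eq by simp
      moreover have "w A \<in> {0, \<infinity>}" "w' A \<in> {0, \<infinity>}"
        using w w' A by (auto simp: lp_set_functions_def PiE_iff)
      ultimately show ?thesis by auto
    qed
    then show "w = w'"
      using w w' by (intro PiE_ext[of w "Pow {1..n}" "\<lambda>_. {0, \<infinity>}"])
        (auto simp: lp_set_functions_def)
  qed
  show "lattice_poly n ` lp_set_functions n = lattice_polynomials n"
  proof
    show "lattice_poly n ` lp_set_functions n \<subseteq> lattice_polynomials n"
      using lattice_poly_in_lattice_polynomials by blast
    show "lattice_polynomials n \<subseteq> lattice_poly n ` lp_set_functions n"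
    proof
      fix p assume "p \<in> lattice_polynomials n"
      then show "p \<in> lattice_poly n ` lp_set_functions n"
      proof induction
        case (proj k)
        let ?w = "\<lambda>A\<in>Pow {1..n}. if k \<in> A then \<infinity> else (0::ennreal)"
        have w: "?w \<in> lp_set_functions n" using proj by (intro lp_set_functionI) auto
        have "(\<lambda>t. t k) = lattice_poly n ?w" using proj by (intro lattice_poly_eqI[OF w]) auto
        with w show ?case by blast
      next
        case (inf p q)
        then obtain a b where a: "a \<in> lp_set_functions n" "p = lattice_poly n a"
          and b: "b \<in> lp_set_functions n" "q = lattice_poly n b" by blast
        let ?w = "\<lambda>A\<in>Pow {1..n}. if a A = \<infinity> \<and> b A = \<infinity> then \<infinity> else (0::ennreal)"
        have w: "?w \<in> lp_set_functions n"
        proof (rule lp_set_functionI)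
          fix A B assume AB: "A \<subseteq> B" "B \<subseteq> {1..n}" and "a A = \<infinity> \<and> b A = \<infinity>"
          then show "a B = \<infinity> \<and> b B = \<infinity>"
            using lp_set_function_infty_mono[OF a(1) AB] lp_set_function_infty_mono[OF b(1) AB]
            by blast
        qed (use lp_set_function_bounds[OF a(1)] lp_set_function_bounds[OF b(1)] in simp_all)
        have "(\<lambda>t. inf (p t) (q t)) = lattice_poly n ?w"
          using less_lattice_poly_iff[OF a(1)] less_lattice_poly_iff[OF b(1)]
          by (intro lattice_poly_eqI[OF w]) (auto simp: a b inf_min)
        with w show ?case by blast
      next
        case (sup p q)
        then obtain a b where a: "a \<in> lp_set_functions n" "p = lattice_poly n a"
          and b: "b \<in> lp_set_functions n" "q = lattice_poly n b" by blast
        let ?w = "\<lambda>A\<in>Pow {1..n}. if a A = \<infinity> \<or> b A = \<infinity> then \<infinity> else (0::ennreal)"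
        have w: "?w \<in> lp_set_functions n"
        proof (rule lp_set_functionI)
          fix A B assume AB: "A \<subseteq> B" "B \<subseteq> {1..n}" and "a A = \<infinity> \<or> b A = \<infinity>"
          then show "a B = \<infinity> \<or> b B = \<infinity>"
            using lp_set_function_infty_mono[OF a(1) AB] lp_set_function_infty_mono[OF b(1) AB]
            by blast
        qed (use lp_set_function_bounds[OF a(1)] lp_set_function_bounds[OF b(1)] in simp_all)
        have "(\<lambda>t. sup (p t) (q t)) = lattice_poly n ?w"
          using less_lattice_poly_iff[OF a(1)] less_lattice_poly_iff[OF b(1)]
          by (intro lattice_poly_eqI[OF w]) (auto simp: a b sup_max less_max_iff_disj)
        with w show ?case by blast
      qed
    qed
  qed
qed

end

theory Submission
  imports Defs
begin

text \<open>A lifetime in \<open>[0,\<infinity>]\<close> is determined by the set of finite times that it survives, so it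
  suffices to compare the two descriptions of the system at each time \<open>t \<ge> 0\<close>. Let
  \<open>B = {i. T\<^sub>i > t}\<close> be the set of components alive at \<open>t\<close>. The state vector is then the
  characteristic vector of \<open>B\<close>, so by \<open>boolean_fun_char_vec\<close> the structure function \<open>\<phi>\<^sub>v\<close> says that
  the system is alive at \<open>t\<close> iff \<open>v B = 1\<close> (\<open>has_structure_function_iff\<close>). The lattice polynomial
  \<open>p\<^sub>w\<close>, a maximum of minima, exceeds \<open>t\<close> iff some \<open>A\<close> with \<open>w A = \<infinity>\<close> is contained in \<open>B\<close>; by
  monotonicity of \<open>w\<close> this means \<open>w B = \<infinity>\<close>. For \<open>w = \<gamma> \<circ> v\<close> these conditions coincide, and so the
  two descriptions are equivalent (\<open>has_structure_function_iff_lattice_poly\<close>).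

  Both directions of the theorem are instances of this equivalence. What remains is to match the
  side conditions: characteristic vectors identify \<open>Pow {1..n}\<close> with \<open>{0,1}\<^sup>n\<close> as ordered sets, so
  \<open>\<phi>\<^sub>v\<close> is nondecreasing or constant iff \<open>v\<close> is, and \<open>\<gamma>\<close> is an order isomorphism from \<open>{0,1}\<close>
  onto \<open>{0,\<infinity>}\<close>.\<close>

definition char_vec :: "nat \<Rightarrow> nat set \<Rightarrow> nat \<Rightarrow> nat" where
  "char_vec n A = (\<lambda>i\<in>{1..n}. of_bool (i \<in> A))"

lemma char_vec_image_Pow: "char_vec n ` Pow {1..n} = states n"
proof
  show "char_vec n ` Pow {1..n} \<subseteq> states n"
    by (auto simp: char_vec_def states_def)
  show "states n \<subseteq> char_vec n ` Pow {1..n}"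
  proof
    fix x assume x: "x \<in> states n"
    have "x i = char_vec n {i \<in> {1..n}. x i = 1} i" for i
      using x by (cases "i \<in> {1..n}") (auto simp: char_vec_def states_def PiE_iff extensional_def)
    then have "x = char_vec n {i \<in> {1..n}. x i = 1}" by blast
    then show "x \<in> char_vec n ` Pow {1..n}" by blast
  qed
qed

lemma char_vec_le_iff:
  assumes "A \<subseteq> {1..n}"
  shows "char_vec n A \<le> char_vec n B \<longleftrightarrow> A \<subseteq> B"
proof
  assume le: "char_vec n A \<le> char_vec n B"
  show "A \<subseteq> B"
  proof
    fix i assume "i \<in> A"
    then show "i \<in> B"
      using le_funD[OF le, of i] assms by (cases "i \<in> B") (auto simp: char_vec_def subset_iff)
  qed
qed (auto simp: char_vec_def le_fun_def)

text \<open>At the characteristic vector of \<open>A\<close>, the product belonging to a set \<open>B \<noteq> A\<close> has a zero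
  factor: some \<open>x\<^sub>i\<close> with \<open>i \<in> B - A\<close>, or some \<open>1 - x\<^sub>i\<close> with \<open>i \<in> A - B\<close>.\<close>

lemma boolean_fun_char_vec:
  assumes A: "A \<subseteq> {1..n}"
  shows "boolean_fun n v (char_vec n A) = v A"
proof -
  let ?x = "char_vec n A"
  let ?term = "\<lambda>B. v B * (\<Prod>i\<in>B. ?x i) * (\<Prod>i\<in>{1..n} - B. 1 - ?x i)"
  have zero: "?term B = 0" if B: "B \<subseteq> {1..n}" "B \<noteq> A" for B
  proof -
    have fin: "finite B" using B(1) finite_subset by blast
    obtain i where "i \<in> B - A \<or> i \<in> A - B" using B(2) by blast
    then show ?thesis
    proof
      assume i: "i \<in> B - A"
      then have "?x i = 0" using B(1) by (auto simp: char_vec_def)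
      then have "(\<Prod>i\<in>B. ?x i) = 0" using i fin by (intro prod_zero) auto
      then show ?thesis by simp
    next
      assume i: "i \<in> A - B"
      then have "1 - ?x i = 0" using A by (auto simp: char_vec_def)
      then have "(\<Prod>i\<in>{1..n} - B. 1 - ?x i) = 0" using i A by (intro prod_zero) auto
      then show ?thesis by simp
    qed
  qed
  have "boolean_fun n v ?x = (\<Sum>B\<in>{A}. ?term B)"
    unfolding boolean_fun_def using A zero by (intro sum.mono_neutral_right) auto
  also have "\<dots> = v A"
  proof -
    have "(\<Prod>i\<in>A. ?x i) = 1" using A by (intro prod.neutral) (auto simp: char_vec_def)
    moreover have "(\<Prod>i\<in>{1..n} - A. 1 - ?x i) = 1"
      by (intro prod.neutral) (auto simp: char_vec_def)
    ultimately show ?thesis by simp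
  qed
  finally show ?thesis .
qed

lemma mono_on_boolean_fun_iff:
  "mono_on (states n) (boolean_fun n v) \<longleftrightarrow> mono_on (Pow {1..n}) v"
proof -
  have "mono_on (states n) (boolean_fun n v) \<longleftrightarrow>
      (\<forall>A\<in>Pow {1..n}. \<forall>B\<in>Pow {1..n}. char_vec n A \<le> char_vec n B \<longrightarrow>
        boolean_fun n v (char_vec n A) \<le> boolean_fun n v (char_vec n B))"
    unfolding char_vec_image_Pow[symmetric] monotone_on_def by blast
  also have "\<dots> \<longleftrightarrow> (\<forall>A\<in>Pow {1..n}. \<forall>B\<in>Pow {1..n}. A \<subseteq> B \<longrightarrow> v A \<le> v B)"
    by (simp add: char_vec_le_iff boolean_fun_char_vec)
  finally show ?thesis unfolding monotone_on_def by blast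
qed

lemma boolean_fun_constant_on_iff:
  "boolean_fun n v constant_on states n \<longleftrightarrow> v constant_on Pow {1..n}"
  by (simp add: char_vec_image_Pow[symmetric] constant_on_def boolean_fun_char_vec)

lemma boolean_set_function_range:
  assumes "v \<in> boolean_set_functions n" "A \<subseteq> {1..n}"
  shows "v A \<in> {0, 1}"
  using assms by (auto simp: boolean_set_functions_def PiE_iff)

text \<open>Monotonicity and nonconstancy pass between \<open>v\<close> and \<open>\<gamma> \<circ> v\<close> in both directions, because
  \<open>\<gamma>\<close> preserves and reflects the order of \<open>{0,1}\<close>.\<close>

lemma compose_gamma_in_lp_set_functions_iff:
  assumes v: "v \<in> boolean_set_functions n"
  shows "compose (Pow {1..n}) gamma v \<in> lp_set_functions n \<longleftrightarrow>
    mono_on (Pow {1..n}) v \<and> \<not> v constant_on Pow {1..n}"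
proof -
  let ?w = "compose (Pow {1..n}) gamma v"
  have gamma_le: "gamma (v A) \<le> gamma (v B) \<longleftrightarrow> v A \<le> v B"
    if "A \<subseteq> {1..n}" "B \<subseteq> {1..n}" for A B
    using boolean_set_function_range[OF v that(1)] boolean_set_function_range[OF v that(2)]
    by (auto simp: gamma_def)
  have "?w \<in> Pow {1..n} \<rightarrow>\<^sub>E {0, \<infinity>}" by (auto simp: compose_def gamma_def)
  moreover have "mono_on (Pow {1..n}) ?w \<longleftrightarrow> mono_on (Pow {1..n}) v"
    using gamma_le by (auto simp: monotone_on_def compose_def)
  moreover have "?w constant_on Pow {1..n} \<longleftrightarrow> v constant_on Pow {1..n}"
  proof -
    have const: "f constant_on Pow {1..n} \<longleftrightarrow>
        (\<forall>A\<in>Pow {1..n}. \<forall>B\<in>Pow {1..n}. f A = f B)" for f :: "nat set \<Rightarrow> 'b"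
      unfolding constant_on_def by (metis Pow_bottom)
    have "gamma (v A) = gamma (v B) \<longleftrightarrow> v A = v B" if "A \<subseteq> {1..n}" "B \<subseteq> {1..n}" for A B
      using gamma_le[OF that] gamma_le[OF that(2,1)] by (metis antisym order_refl)
    then show ?thesis unfolding const by (simp add: compose_eq)
  qed
  ultimately show ?thesis by (auto simp: lp_set_functions_def)
qed

lemma gamma_inv_simps [simp]: "gamma_inv 0 = 0" "gamma_inv \<top> = 1"
proof -
  have "inj_on gamma {0, 1}" by (auto simp: inj_on_def gamma_def)
  from the_inv_into_f_f[OF this, of 0] the_inv_into_f_f[OF this, of 1]
  show "gamma_inv 0 = 0" "gamma_inv \<top> = 1" by (simp_all add: gamma_inv_def gamma_def)
qed

lemma compose_gamma_inv:
  assumes w: "w \<in> lp_set_functions n"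
  shows "compose (Pow {1..n}) gamma_inv w \<in> boolean_set_functions n"
    and "compose (Pow {1..n}) gamma (compose (Pow {1..n}) gamma_inv w) = w"
proof -
  let ?v = "compose (Pow {1..n}) gamma_inv w"
  have range: "w A \<in> {0, \<infinity>}" if "A \<in> Pow {1..n}" for A
    using w that by (auto simp: lp_set_functions_def PiE_iff)
  have ext: "w \<in> extensional (Pow {1..n})"
    using w by (auto simp: lp_set_functions_def PiE_def)
  show "?v \<in> boolean_set_functions n"
    unfolding boolean_set_functions_def
  proof (rule PiE_I)
    fix A assume "A \<in> Pow {1..n}"
    with range[OF this] show "?v A \<in> {0, 1}" by (auto simp: compose_eq)
  qed (simp add: compose_def)
  show "compose (Pow {1..n}) gamma ?v = w"
  proof (rule extensionalityI[OF compose_extensional ext])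
    fix A assume "A \<in> Pow {1..n}"
    with range[OF this] show "compose (Pow {1..n}) gamma ?v A = w A"
      by (auto simp: compose_def gamma_def)
  qed
qed

lemma ennreal_eqI_less_real:
  fixes a b :: ennreal
  assumes "\<And>t. t \<ge> 0 \<Longrightarrow> ennreal t < a \<longleftrightarrow> ennreal t < b"
  shows "a = b"
proof -
  have le: "c \<le> d" if "\<And>t. t \<ge> 0 \<Longrightarrow> ennreal t < c \<Longrightarrow> ennreal t < d" for c d :: ennreal
  proof (rule ccontr)
    assume "\<not> c \<le> d"
    then have "d < c" by simp
    \<comment> \<open>The smaller of the two values is finite, hence itself a time at which they differ.\<close>
    then obtain t where "t \<ge> 0" "d = ennreal t" by (cases d) auto
    with that[of t] \<open>d < c\<close> show False by simp
  qed
  show ?thesis using assms by (intro antisym le) auto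
qed

lemma has_structure_function_iff:
  assumes v: "v \<in> boolean_set_functions n"
  shows "has_structure_function n M T T\<^sub>S (boolean_fun n v) \<longleftrightarrow>
    (\<forall>t\<ge>0. \<forall>\<omega>\<in>space M.
      ennreal t < T\<^sub>S \<omega> \<longleftrightarrow> v {i \<in> {1..n}. ennreal t < T i \<omega>} = 1)"
proof -
  have "boolean_fun n v \<in> states n \<rightarrow> {0, 1}"
  proof
    fix x assume "x \<in> states n"
    then obtain A where "A \<subseteq> {1..n}" "x = char_vec n A"
      unfolding char_vec_image_Pow[symmetric] by blast
    then show "boolean_fun n v x \<in> {0, 1}"
      using boolean_set_function_range[OF v, of A] by (simp only: boolean_fun_char_vec)
  qed
  moreover have "state_at T\<^sub>S t \<omega> = boolean_fun n v (\<lambda>i\<in>{1..n}. state_at (T i) t \<omega>) \<longleftrightarrow>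
      (ennreal t < T\<^sub>S \<omega> \<longleftrightarrow> v {i \<in> {1..n}. ennreal t < T i \<omega>} = 1)" for t \<omega>
  proof -
    let ?B = "{i \<in> {1..n}. ennreal t < T i \<omega>}"
    have "(\<lambda>i\<in>{1..n}. state_at (T i) t \<omega>) = char_vec n ?B"
      by (auto simp: char_vec_def state_at_def fun_eq_iff)
    then have "boolean_fun n v (\<lambda>i\<in>{1..n}. state_at (T i) t \<omega>) = v ?B"
      using boolean_fun_char_vec[of ?B n v] by (simp only:) blast
    moreover have "v ?B \<in> {0, 1}" by (rule boolean_set_function_range[OF v]) auto
    ultimately show ?thesis by (auto simp: state_at_def indicator_def)
  qed
  ultimately show ?thesis by (simp add: has_structure_function_def)
qed

text \<open>At a fixed time both sides say that the set of surviving components is a set on which \<open>v\<close> is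
  \<open>1\<close>; comparing all finite times recovers the equality of the lifetimes.\<close>

lemma has_structure_function_iff_lattice_poly:
  assumes v: "v \<in> boolean_set_functions n"
    and w: "compose (Pow {1..n}) gamma v \<in> lp_set_functions n" (is "?w \<in> _")
  shows "has_structure_function n M T T\<^sub>S (boolean_fun n v) \<longleftrightarrow>
    (\<forall>\<omega>\<in>space M. T\<^sub>S \<omega> = lattice_poly n ?w (\<lambda>i\<in>{1..n}. T i \<omega>))"
proof -
  have survives: "ennreal t < lattice_poly n ?w (\<lambda>i\<in>{1..n}. T i \<omega>) \<longleftrightarrow>
      v {i \<in> {1..n}. ennreal t < T i \<omega>} = 1" for t \<omega>
  proof -
    let ?B = "{i \<in> {1..n}. ennreal t < T i \<omega>}"
    have "{i \<in> {1..n}. ennreal t < (\<lambda>i\<in>{1..n}. T i \<omega>) i} = ?B" by auto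
    then have "ennreal t < lattice_poly n ?w (\<lambda>i\<in>{1..n}. T i \<omega>) \<longleftrightarrow> ?w ?B = \<infinity>"
      by (simp only: less_lattice_poly_iff[OF w])
    moreover have "?B \<in> Pow {1..n}" by auto
    then have "?w ?B = gamma (v ?B)" by (simp only: compose_eq)
    moreover have "v ?B \<in> {0, 1}" by (rule boolean_set_function_range[OF v]) auto
    ultimately show ?thesis by (auto simp: gamma_def)
  qed
  show ?thesis
    unfolding has_structure_function_iff[OF v] survives[symmetric]
    using ennreal_eqI_less_real by auto
qed

theorem theorem2:
  fixes M :: "'a measure" and n :: nat
    and T :: "nat \<Rightarrow> 'a \<Rightarrow> ennreal" and T\<^sub>S :: "'a \<Rightarrow> ennreal"
  assumes "prob_space M"
    and "n \<ge> 1"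
    and "\<forall>i\<in>{1..n}. T i \<in> borel_measurable M"
    and "T\<^sub>S \<in> borel_measurable M"
  shows
    "(\<forall>v\<in>boolean_set_functions n.
        mono_on (states n) (boolean_fun n v) \<longrightarrow>
        \<not> boolean_fun n v constant_on states n \<longrightarrow>
        has_structure_function n M T T\<^sub>S (boolean_fun n v) \<longrightarrow>
        (let w = compose (Pow {1..n}) gamma v in
          w \<in> lp_set_functions n \<and>
          (\<forall>\<omega>\<in>space M. T\<^sub>S \<omega> = lattice_poly n w (\<lambda>i\<in>{1..n}. T i \<omega>))))
     \<and>
     (\<forall>p\<in>lattice_polynomials n. \<forall>w\<in>lp_set_functions n.
        p = lattice_poly n w \<longrightarrow>
        (\<forall>\<omega>\<in>space M. T\<^sub>S \<omega> = p (\<lambda>i\<in>{1..n}. T i \<omega>)) \<longrightarrow>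
        (let v = compose (Pow {1..n}) gamma_inv w in
          v \<in> boolean_set_functions n \<and>
          mono_on (states n) (boolean_fun n v) \<and>
          \<not> boolean_fun n v constant_on states n \<and>
          has_structure_function n M T T\<^sub>S (boolean_fun n v)))"
proof (intro conjI ballI impI)
  fix v assume v: "v \<in> boolean_set_functions n"
    and mono: "mono_on (states n) (boolean_fun n v)"
    and nonconst: "\<not> boolean_fun n v constant_on states n"
    and sys: "has_structure_function n M T T\<^sub>S (boolean_fun n v)"
  have w: "compose (Pow {1..n}) gamma v \<in> lp_set_functions n"
    using mono nonconst compose_gamma_in_lp_set_functions_iff[OF v]
    by (simp add: mono_on_boolean_fun_iff boolean_fun_constant_on_iff)
  with sys show "let w = compose (Pow {1..n}) gamma v in w \<in> lp_set_functions n \<and>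
      (\<forall>\<omega>\<in>space M. T\<^sub>S \<omega> = lattice_poly n w (\<lambda>i\<in>{1..n}. T i \<omega>))"
    unfolding Let_def has_structure_function_iff_lattice_poly[OF v w] by blast
next
  fix p w assume w: "w \<in> lp_set_functions n" and p: "p = lattice_poly n w"
    and lifetime: "\<forall>\<omega>\<in>space M. T\<^sub>S \<omega> = p (\<lambda>i\<in>{1..n}. T i \<omega>)"
  define v where "v = compose (Pow {1..n}) gamma_inv w"
  have v: "v \<in> boolean_set_functions n" and w_eq: "compose (Pow {1..n}) gamma v = w"
    unfolding v_def using compose_gamma_inv[OF w] .
  have "mono_on (states n) (boolean_fun n v)" "\<not> boolean_fun n v constant_on states n"
    using w compose_gamma_in_lp_set_functions_iff[OF v]
    unfolding w_eq mono_on_boolean_fun_iff boolean_fun_constant_on_iff by blast+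
  moreover have "has_structure_function n M T T\<^sub>S (boolean_fun n v)"
    using has_structure_function_iff_lattice_poly[OF v, unfolded w_eq, OF w] lifetime
    unfolding p by blast
  ultimately show "let v = compose (Pow {1..n}) gamma_inv w in
      v \<in> boolean_set_functions n \<and> mono_on (states n) (boolean_fun n v) \<and>
      \<not> boolean_fun n v constant_on states n \<and>
      has_structure_function n M T T\<^sub>S (boolean_fun n v)"
    using v unfolding v_def Let_def by blast
qed

end
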